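(* Let $G=(V,E)$ be a finite simple graph and $t\colon V\to C$ a template for $G$, and let $s\ge 1$. There is a paint plan with $s$ strokes that paints $t$ onto $G$ if and only if there is a flooding sequence of $s-1$ moves for $G$ when $G$ is initially painted with $t$.
   Context: A vertex set $A\subseteq V$ is connected if $G[A]$ is connected. A painting is a (possibly partial) function $p\colon V\to C$; a template is a total painting. A set $A$ is monochromatic in $p$ if $p(v)=p(w)$ for all $v,w\in A$ (this includes the case that $p$ is undefined on all of $A$). A color component of $G$ under $p$ is a connected monochromatic set not properly contained in any connected monochromatic set. A brush stroke is a pair $(A,c)$ with $A\subseteq V$ connected and $c\in C$; applying it to $p$ gives $p'$ with $p'(v)=c$ for $v\in A$ and $p'(v)=p(v)$ otherwise. A paint plan painting $t$ onto $G$ with $s$ strokes is a non-empty sequence $(A_1,c_1),\dots,(A_s,c_s)$ of strokes such that, starting from the everywhere-undefined painting $p_0$ and applying the strokes successively, the resulting painting $p_s$ equals $t$. Free Flood-It: $G$ is initially painted with a total painting $q_0$. A move $(v,c)$ with $v\in V$, $c\in C$ transforms the current painting $q_{i-1}$ into $q_i$, where $q_i(u)=c$ if $u$ lies in the same color component as $v$ with respect to $q_{i-1}$, and $q_i(u)=q_{i-1}(u)$ otherwise. A flooding sequence of $m$ moves (possibly $m=0$) is a sequence of $m$ moves such that the final painting $q_m$ is constant on $V$.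
   Formalization: The graph G is additionally assumed connected and non-empty; otherwise the claim fails: for two isolated vertices, a constant template and s = 1, zero moves suffice but no single brush stroke paints both vertices. *)

theory Defs
  imports "Graph_Theory.Graph_Theory"
begin

(* A finite simple graph is a symmetric digraph satisfying the locale predicate graph of
   Digraph (finite, loop-free, no parallel arcs); each edge is a pair of opposite arcs.
   The set of colors is the type 'c. *)

(* The library predicate connected requires a non-empty vertex set, so the empty set
   is not a connected vertex set. *)
definition connected_set :: "('v, 'e) pre_digraph \<Rightarrow> 'v set \<Rightarrow> bool" where
  "connected_set G A \<longleftrightarrow> A \<subseteq> verts G \<and> connected (G \<restriction> A)"

definition painting :: "('v, 'e) pre_digraph \<Rightarrow> ('v \<rightharpoonup> 'c) \<Rightarrow> bool" where
  "painting G p \<longleftrightarrow> dom p \<subseteq> verts G"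

definition template :: "('v, 'e) pre_digraph \<Rightarrow> ('v \<rightharpoonup> 'c) \<Rightarrow> bool" where
  "template G t \<longleftrightarrow> painting G t \<and> verts G \<subseteq> dom t"

definition monochromatic :: "('v \<rightharpoonup> 'c) \<Rightarrow> 'v set \<Rightarrow> bool" where
  "monochromatic p A \<longleftrightarrow> (\<forall>v\<in>A. \<forall>w\<in>A. p v = p w)"

definition color_component :: "('v, 'e) pre_digraph \<Rightarrow> ('v \<rightharpoonup> 'c) \<Rightarrow> 'v set \<Rightarrow> bool" where
  "color_component G p A \<longleftrightarrow> connected_set G A \<and> monochromatic p A \<and>
     \<not> (\<exists>B. connected_set G B \<and> monochromatic p B \<and> A \<subset> B)"

type_synonym ('v, 'c) stroke = "'v set \<times> 'c"

definition brush_stroke :: "('v, 'e) pre_digraph \<Rightarrow> ('v, 'c) stroke \<Rightarrow> bool" where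
  "brush_stroke G S \<longleftrightarrow> connected_set G (fst S)"

fun apply_stroke :: "('v, 'c) stroke \<Rightarrow> ('v \<rightharpoonup> 'c) \<Rightarrow> ('v \<rightharpoonup> 'c)" where
  "apply_stroke (A, c) p = (\<lambda>v. if v \<in> A then Some c else p v)"

definition paint_plan :: "('v, 'e) pre_digraph \<Rightarrow> ('v \<rightharpoonup> 'c) \<Rightarrow> ('v, 'c) stroke list \<Rightarrow> bool" where
  "paint_plan G t P \<longleftrightarrow> P \<noteq> [] \<and> (\<forall>S\<in>set P. brush_stroke G S) \<and>
     fold apply_stroke P Map.empty = t"

type_synonym ('v, 'c) move = "'v \<times> 'c"

fun apply_move :: "('v, 'e) pre_digraph \<Rightarrow> ('v, 'c) move \<Rightarrow> ('v \<rightharpoonup> 'c) \<Rightarrow> ('v \<rightharpoonup> 'c)" where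
  "apply_move G (v, c) q =
     (\<lambda>u. if \<exists>A. color_component G q A \<and> v \<in> A \<and> u \<in> A then Some c else q u)"

(* The initial painting q0 is total, hence so is the final one: monochromatic on the
   vertex set then means constant with a single color. *)
definition flooding_sequence ::
    "('v, 'e) pre_digraph \<Rightarrow> ('v \<rightharpoonup> 'c) \<Rightarrow> ('v, 'c) move list \<Rightarrow> bool" where
  "flooding_sequence G q0 M \<longleftrightarrow> template G q0 \<and> (\<forall>m\<in>set M. fst m \<in> verts G) \<and>
     monochromatic (fold (apply_move G) M q0) (verts G)"

end

(* A flooding move recolors a color component, and the brush stroke that paints the old color
   back onto this component undoes it; running a flooding sequence backwards from a single
   stroke on all vertices gives a paint plan.  Conversely, enlarge the last stroke of a plan to
   the color component D of t containing it.  Adding D to every earlier stroke that meets D or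
   is adjacent to D leaves the painting unchanged outside D and makes it constant on D, so the
   earlier strokes then paint the result of a single flooding move on D, and one inducts. *)
theory Submission
  imports Defs
begin

context sym_digraph
begin

section \<open>Connected vertex sets\<close>

text \<open>Arcs come in opposite pairs, so the symmetric closure in \<open>connected\<close> adds
  nothing. Later arguments can then follow walks in the single relation
  \<open>arcs_ends G\<close>.\<close>

lemma connected_set_iff_rtrancl_on:
  "connected_set G A \<longleftrightarrow> A \<subseteq> verts G \<and> A \<noteq> {} \<and>
     (\<forall>u\<in>A. \<forall>v\<in>A. (u, v) \<in> rtrancl_on A (arcs_ends G))"
proof (cases "A \<subseteq> verts G")
  case True
  interpret I: wf_digraph "G \<restriction> A"
    by (rule wellformed_induce_subgraph)
  have ends: "arcs_ends (G \<restriction> A) = arcs_ends G \<inter> A \<times> A"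
    by (auto simp: arcs_ends_conv)
  have "sym (arcs_ends G \<inter> A \<times> A)"
    by (auto intro!: symI dest: graph_symmetric)
  then have "(arcs_ends (G \<restriction> A))\<^sup>s = arcs_ends G \<inter> A \<times> A"
    unfolding ends symcl_def by (auto dest: symD)
  \<comment> \<open>\<open>rtrancl_on A\<close> already keeps every vertex of a walk in
    \<open>A\<close>, so restricting the arcs loses nothing.\<close>
  moreover have "(u, v) \<in> rtrancl_on A (arcs_ends G \<inter> A \<times> A) \<longleftrightarrow>
      (u, v) \<in> rtrancl_on A (arcs_ends G)" for u v
  proof
    show "(u, v) \<in> rtrancl_on A (arcs_ends G)"
      if "(u, v) \<in> rtrancl_on A (arcs_ends G \<inter> A \<times> A)"
      using that by (induction rule: rtrancl_on_induct) (auto intro: rtrancl_on_into_rtrancl_on)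
    show "(u, v) \<in> rtrancl_on A (arcs_ends G \<inter> A \<times> A)"
      if "(u, v) \<in> rtrancl_on A (arcs_ends G)"
      using that by (induction rule: rtrancl_on_induct) (auto intro: rtrancl_on_into_rtrancl_on)
  qed
  ultimately show ?thesis
    using True by (simp add: connected_set_def connected_conv)
qed (simp add: connected_set_def)

text \<open>Every vertex reaches \<open>a\<close> inside the union, and symmetry reverses such
  walks. The premise on \<open>a\<close> and \<open>b\<close> covers overlapping as well as adjacent
  sets.\<close>

lemma connected_set_union:
  assumes A: "connected_set G A" and B: "connected_set G B"
    and ab: "a \<in> A" "b \<in> B" "a = b \<or> (a, b) \<in> arcs_ends G"
  shows "connected_set G (A \<union> B)"
proof -
  let ?R = "rtrancl_on (A \<union> B) (arcs_ends G)"
  have mono: "(u, v) \<in> ?R" if "(u, v) \<in> rtrancl_on C (arcs_ends G)" "C \<subseteq> A \<union> B" for u v C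
    using that by (induction rule: rtrancl_on_induct) (auto intro: rtrancl_on_into_rtrancl_on)
  have sym: "sym ?R"
    by (rule rtrancl_on_sym) (use sym_arcs in \<open>simp add: symmetric_def\<close>)
  have "(a, b) \<in> ?R"
    using ab by (auto intro: rtrancl_on_into_rtrancl_on)
  then have ba: "(b, a) \<in> ?R"
    using sym by (auto dest: symD)
  have to_a: "(u, a) \<in> ?R" if "u \<in> A \<union> B" for u
    using that A B ab ba mono[of _ _ A] mono[of _ _ B]
    unfolding connected_set_iff_rtrancl_on by (blast intro: rtrancl_on_trans)
  then have "(u, v) \<in> ?R" if "u \<in> A \<union> B" "v \<in> A \<union> B" for u v
    using that sym by (blast intro: rtrancl_on_trans dest: symD)
  with A B show ?thesis
    unfolding connected_set_iff_rtrancl_on by blast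
qed

lemma connected_set_singleton: "v \<in> verts G \<Longrightarrow> connected_set G {v}"
  unfolding connected_set_iff_rtrancl_on by auto

lemma connected_set_verts:
  assumes "connected G"
  shows "connected_set G (verts G)"
proof -
  have "(arcs_ends G)\<^sup>s = arcs_ends G"
    by (auto simp: symcl_def dest: graph_symmetric)
  with assms show ?thesis
    unfolding connected_set_iff_rtrancl_on connected_conv by simp
qed

lemma connected_boundary_arc:
  assumes "connected G" "D \<subset> verts G" "D \<noteq> {}"
  obtains d u where "d \<in> D" "u \<in> verts G - D" "(d, u) \<in> arcs_ends G"
proof -
  obtain x y where "x \<in> D" "y \<in> verts G - D"
    using assms by blast
  then have "(x, y) \<in> rtrancl_on (verts G) (arcs_ends G)"
    using connected_set_verts[OF assms(1)] assms(2)
    unfolding connected_set_iff_rtrancl_on by blast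
  \<comment> \<open>Invariant along the walk from \<open>x\<close>: it is still in \<open>D\<close>,
    or some arc leaving \<open>D\<close> has been found.\<close>
  then have "y \<in> D \<or> (\<exists>d\<in>D. \<exists>u\<in>verts G - D. (d, u) \<in> arcs_ends G)"
    by (induction rule: rtrancl_on_induct) (use \<open>x \<in> D\<close> in auto)
  then show ?thesis
    using \<open>y \<in> verts G - D\<close> that by blast
qed

section \<open>Color components\<close>

text \<open>Otherwise \<open>D \<union> B\<close>, joined at \<open>v\<close>, would contradict the
  maximality of \<open>D\<close>.\<close>

lemma subset_color_component:
  assumes D: "color_component G p D" and v: "v \<in> D"
    and B: "connected_set G B" "monochromatic p B" "v \<in> B"
  shows "B \<subseteq> D"
proof (rule ccontr)
  assume "\<not> B \<subseteq> D"
  moreover have "connected_set G (D \<union> B)"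
    using connected_set_union[of D B v v] D B v by (auto simp: color_component_def)
  moreover have "p u = p v" if "u \<in> D \<union> B" for u
    using that D B v unfolding color_component_def monochromatic_def by blast
  then have "monochromatic p (D \<union> B)"
    by (simp add: monochromatic_def)
  ultimately show False
    using D unfolding color_component_def by blast
qed

text \<open>By maximality only one component contains \<open>v\<close>, so the existential in
  \<open>apply_move\<close> picks out exactly \<open>D\<close>. This turns moves into
  strokes.\<close>

lemma apply_move_color_component:
  assumes "color_component G q D" "v \<in> D"
  shows "apply_move G (v, c) q = apply_stroke (D, c) q"
proof -
  have "(\<exists>A. color_component G q A \<and> v \<in> A \<and> u \<in> A) \<longleftrightarrow> u \<in> D" for u
    using assms subset_color_component[OF assms]
    by (auto simp: color_component_def)
  then show ?thesis
    by auto
qed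

end

lemma (in graph) color_component_exists:
  assumes "v \<in> verts G"
  obtains D where "color_component G p D" "v \<in> D"
proof -
  let ?S = "{A. connected_set G A \<and> monochromatic p A}"
  have "?S \<subseteq> Pow (verts G)"
    by (auto simp: connected_set_def)
  then have "finite ?S"
    by (rule finite_subset) simp
  moreover have "{v} \<in> ?S"
    using assms by (simp add: connected_set_singleton monochromatic_def)
  ultimately obtain D where "D \<in> ?S" "{v} \<subseteq> D" "\<forall>B\<in>?S. D \<subseteq> B \<longrightarrow> D = B"
    by (rule finite_has_maximal2[of ?S "{v}", elim_format]) (elim bexE conjE)
  then show ?thesis
    using that[of D] by (auto simp: color_component_def)
qed

section \<open>From flooding sequences to paint plans\<close>

lemma template_apply_stroke:
  assumes "template G t" "A \<subseteq> verts G"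
  shows "template G (apply_stroke (A, c) t)"
proof -
  have "dom (apply_stroke (A, c) t) = A \<union> dom t"
    by auto
  with assms show ?thesis
    unfolding template_def painting_def by blast
qed

lemma flooding_sequence_Cons:
  assumes "template G t" "v \<in> verts G"
    and "flooding_sequence G (apply_move G (v, c) t) M"
  shows "flooding_sequence G t ((v, c) # M)"
  using assms by (simp add: flooding_sequence_def del: apply_move.simps)

lemma (in graph) flooding_imp_paint_plan:
  assumes "connected G" "flooding_sequence G t M"
  shows "\<exists>P. paint_plan G t P \<and> length P = Suc (length M)"
  using assms(2)
proof (induction M arbitrary: t)
  case Nil
  then have t: "template G t" "monochromatic t (verts G)"
    by (auto simp: flooding_sequence_def)
  \<comment> \<open>A connected graph has a vertex; its color is that of the single stroke matching
    zero moves.\<close>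
  have V: "connected_set G (verts G)"
    using assms(1) by (rule connected_set_verts)
  then obtain v where v: "v \<in> verts G"
    unfolding connected_set_iff_rtrancl_on by blast
  then obtain c where "t v = Some c"
    using t(1) by (auto simp: template_def)
  then have "t u = (if u \<in> verts G then Some c else None)" for u
    using t v unfolding template_def painting_def monochromatic_def by (metis domIff subsetD)
  then have "apply_stroke (verts G, c) Map.empty = t"
    by (simp add: fun_eq_iff)
  then have "paint_plan G t [(verts G, c)]"
    using V by (simp add: paint_plan_def brush_stroke_def)
  then show ?case
    by force
next
  case (Cons m M)
  obtain v c where m: "m = (v, c)"
    by (cases m)
  have v: "v \<in> verts G" and t: "template G t"
    using Cons.prems by (auto simp: flooding_sequence_def m)
  obtain D where D: "color_component G t D" "v \<in> D"
    using color_component_exists[OF v] .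
  have mD: "apply_move G m t = apply_stroke (D, c) t"
    unfolding m using D by (rule apply_move_color_component)
  have "D \<subseteq> verts G"
    using D by (auto simp: color_component_def connected_set_def)
  then have "flooding_sequence G (apply_stroke (D, c) t) M"
    using Cons.prems template_apply_stroke[OF t]
    by (simp add: flooding_sequence_def mD del: apply_move.simps apply_stroke.simps)
  then obtain P where P: "paint_plan G (apply_stroke (D, c) t) P" "length P = Suc (length M)"
    using Cons.IH by blast
  obtain b where "t v = Some b"
    using t v by (auto simp: template_def)
  then have "\<forall>u\<in>D. t u = Some b"
    using D unfolding color_component_def monochromatic_def by metis
  then have "apply_stroke (D, b) (apply_stroke (D, c) t) = t"
    by (auto simp: fun_eq_iff)
  then have "paint_plan G t (P @ [(D, b)])"
    using P(1) D(1)
    by (auto simp: paint_plan_def brush_stroke_def color_component_def simp del: apply_stroke.simps)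
  then show ?case
    using P(2) by force
qed

section \<open>From paint plans to flooding sequences\<close>

text \<open>For connected \<open>fst S\<close> and \<open>D\<close>, the test says that the two sets
  meet or are adjacent. Phrased through the union, it makes the grown set a legal stroke at
  once.\<close>

definition grow_stroke :: "('v, 'e) pre_digraph \<Rightarrow> 'v set \<Rightarrow> ('v, 'c) stroke \<Rightarrow> ('v, 'c) stroke" where
  "grow_stroke G D S = (if connected_set G (fst S \<union> D) then fst S \<union> D else fst S, snd S)"

lemma brush_stroke_grow_stroke: "brush_stroke G S \<Longrightarrow> brush_stroke G (grow_stroke G D S)"
  by (simp add: brush_stroke_def grow_stroke_def)

text \<open>Strokes never erase a color. This is used both to find a stroke covering a painted
  vertex and to show that a covered vertex is painted.\<close>

lemma fold_apply_stroke_None_iff: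
  "fold apply_stroke P p u = None \<longleftrightarrow> p u = None \<and> (\<forall>S\<in>set P. u \<notin> fst S)"
  by (induction P arbitrary: p) (auto split: if_splits)

lemma fold_grow_stroke_outside:
  assumes "u \<notin> D"
  shows "fold apply_stroke (map (grow_stroke G D) P) p u = fold apply_stroke P p u"
proof (induction P rule: rev_induct)
  case (snoc S P)
  then show ?case
    using assms by (cases S) (auto simp: grow_stroke_def)
qed simp

text \<open>Each grown stroke contains \<open>D\<close> or misses it, so all vertices of
  \<open>D\<close> have the same history.\<close>

lemma (in sym_digraph) fold_grow_stroke_inside:
  assumes D: "connected_set G D" and P: "\<forall>S\<in>set P. brush_stroke G S"
    and uw: "u \<in> D" "w \<in> D" and p: "p u = p w"
  shows "fold apply_stroke (map (grow_stroke G D) P) p u =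
    fold apply_stroke (map (grow_stroke G D) P) p w"
  using P
proof (induction P rule: rev_induct)
  case (snoc S P)
  obtain A c where S: "S = (A, c)"
    by (cases S)
  \<comment> \<open>A common vertex would make the union connected, so a stroke left ungrown misses
    \<open>D\<close>.\<close>
  have "A \<inter> D = {}" if "\<not> connected_set G (A \<union> D)"
    using that connected_set_union[of A D] D snoc.prems by (auto simp: S brush_stroke_def)
  then show ?case
    using snoc uw by (auto simp: S grow_stroke_def)
qed (simp add: p)

lemma (in graph) paint_plan_imp_flooding:
  assumes "connected G" "template G t" "paint_plan G t P"
  shows "\<exists>M. flooding_sequence G t M \<and> Suc (length M) = length P"
  using assms(2,3)
\<comment> \<open>Induction on the length, since the hypothesis is applied to the grown strokes and
  not to a sublist of the plan.\<close>
proof (induction "length P" arbitrary: P t)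
  case 0
  then show ?case
    by (simp add: paint_plan_def)
next
  case (Suc n)
  then obtain Q A c where P: "P = Q @ [(A, c)]"
    by (metis paint_plan_def rev_exhaust surj_pair)
  define p where "p = fold apply_stroke Q Map.empty"
  have t: "t = apply_stroke (A, c) p" and A: "connected_set G A"
    and Q: "\<forall>S\<in>set Q. brush_stroke G S"
    using Suc.prems by (auto simp: paint_plan_def brush_stroke_def P p_def)
  have A_mono: "monochromatic t A"
    by (simp add: t monochromatic_def)
  show ?case
  proof (cases "Q = []")
    case True
    then have "p = Map.empty"
      by (simp add: p_def)
    \<comment> \<open>As \<open>t\<close> is total, a lone stroke covers every vertex, and zero
      moves suffice.\<close>
    then have "verts G \<subseteq> A"
      using Suc.prems(1) by (auto simp: t template_def dom_def split: if_splits)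
    then have "flooding_sequence G t []"
      using Suc.prems(1) A_mono by (auto simp: flooding_sequence_def monochromatic_def)
    then show ?thesis
      using True by (auto simp: P)
  next
    case False
    obtain v where v: "v \<in> A" "v \<in> verts G"
      using A unfolding connected_set_iff_rtrancl_on by blast
    obtain D where D: "color_component G t D" "v \<in> D"
      using color_component_exists[OF v(2)] .
    have AD: "A \<subseteq> D"
      using subset_color_component[OF D A A_mono v(1)] .
    have D_conn: "connected_set G D" and D_verts: "D \<subseteq> verts G"
      using D by (auto simp: color_component_def connected_set_def)
    let ?Q = "map (grow_stroke G D) Q"
    \<comment> \<open>Some stroke has to grow over \<open>D\<close>; otherwise \<open>D\<close>
      could stay undefined, leaving no color for the move.\<close>
    have "\<exists>S\<in>set Q. connected_set G (fst S \<union> D)"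
    proof (cases "D = verts G")
      case True
      moreover have "fst (hd Q) \<subseteq> verts G"
        using False Q by (auto simp: brush_stroke_def connected_set_def)
      ultimately have "fst (hd Q) \<union> D = D"
        by blast
      then show ?thesis
        using D_conn False by (intro bexI[of _ "hd Q"]) auto
    next
      case neq: False
      obtain d u where du: "d \<in> D" "u \<in> verts G - D" "(d, u) \<in> arcs_ends G"
        using connected_boundary_arc[OF assms(1), of D] neq D_verts D(2) by blast
      \<comment> \<open>\<open>u\<close> lies outside \<open>D\<close>, hence outside the last
        stroke \<open>A\<close>, so an earlier stroke painted it; through \<open>d\<close> that
        stroke is adjacent to \<open>D\<close>.\<close>
      then have "p u \<noteq> None"
        using Suc.prems(1) AD by (auto simp: t template_def dom_def split: if_splits)
      then obtain S where S: "S \<in> set Q" "u \<in> fst S"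
        by (auto simp: p_def fold_apply_stroke_None_iff)
      then have "connected_set G (D \<union> fst S)"
        using connected_set_union[OF D_conn _ du(1) S(2)] du(3) Q by (auto simp: brush_stroke_def)
      then show ?thesis
        using S(1) by (auto simp: Un_commute)
    qed
    then have "\<exists>S\<in>set ?Q. v \<in> fst S"
      using D(2) by (auto simp: grow_stroke_def)
    \<comment> \<open>The color that the grown strokes leave at \<open>v\<close> becomes the color
      of the flooding move.\<close>
    then obtain b where b: "fold apply_stroke ?Q Map.empty v = Some b"
      using fold_apply_stroke_None_iff[of ?Q Map.empty v] by auto
    have "fold apply_stroke ?Q Map.empty u = apply_stroke (D, b) t u" for u
    proof (cases "u \<in> D")
      case True
      then show ?thesis
        using fold_grow_stroke_inside[OF D_conn Q True D(2), of Map.empty] b by simp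
    next
      case False
      \<comment> \<open>Since \<open>A \<subseteq> D\<close>, the last stroke changes nothing here:
        \<open>p\<close> and \<open>t\<close> agree outside \<open>D\<close>.\<close>
      then show ?thesis
        using AD by (auto simp: fold_grow_stroke_outside t p_def)
    qed
    then have "paint_plan G (apply_stroke (D, b) t) ?Q"
      using Q \<open>Q \<noteq> []\<close> by (auto simp: paint_plan_def brush_stroke_grow_stroke
          simp del: apply_stroke.simps)
    then obtain M where M: "flooding_sequence G (apply_stroke (D, b) t) M" "Suc (length M) = n"
      using Suc.hyps(1)[of ?Q] Suc.hyps(2) template_apply_stroke[OF Suc.prems(1) D_verts]
      by (auto simp: P)
    then have "flooding_sequence G t ((v, b) # M)"
      using flooding_sequence_Cons[OF Suc.prems(1) v(2)] apply_move_color_component[OF D]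
      by metis
    then show ?thesis
      using M(2) Suc.hyps(2) by force
  qed
qed

theorem theorem6:
  fixes G :: "('v, 'e) pre_digraph" and t :: "'v \<rightharpoonup> 'c" and s :: nat
  assumes "graph G"
    and "connected G"
    and "template G t"
    and "s \<ge> 1"
  shows "(\<exists>P. paint_plan G t P \<and> length P = s) \<longleftrightarrow>
         (\<exists>M. flooding_sequence G t M \<and> length M = s - 1)"
proof -
  interpret graph G
    by fact
  show ?thesis
    using flooding_imp_paint_plan[OF assms(2), of t] paint_plan_imp_flooding[OF assms(2,3)]
      assms(4)
    by (metis One_nat_def Suc_pred diff_Suc_1 less_eq_Suc_le)
qed

end
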